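(* Let $(X_t)_{t\ge1}$ be an arbitrary data stream (no stationarity or independence assumed), and consider the B-PAC procedure defined in the context with thresholds $$\hat u_t=\max\Big\{u\in\mathcal{U}:\ K_t(u)\ge\frac{1}{\alpha\,\nu(u)}\Big\}$$ (with $\hat u_t=0$ if this set is empty). For any prior probability mass function $\nu:\mathcal{U}\to(0,1]$, $\sum_{u\in\mathcal{U}}\nu(u)=1$, any $\alpha\in(0,1)$, any $\epsilon\in(0,1)$, any exploration probabilities $\rho_t\in(0,1)$, and any nonnegative $\mathcal{F}_{t-1}$-measurable bets $\lambda_t(u)$ with $1+\lambda_t(u)D_t(u)\ge0$ ($t\ge1$, $u\in\mathcal{U}$), we have $$\mathbb{P}\big(\forall t\in\mathbb{N}:\ L_t(\hat u_t)\le\epsilon\big)\ge1-\alpha,$$ where $\mathbb N=\{1,2,\dots\}$ and, for $u\in\mathcal{U}$, $L_t(u)$ is the weighted cumulative risk $$L_t(u)=\sum_{j=1}^t\frac{\lambda_j(u)}{\sum_{i=1}^t\lambda_i(u)}\,\mathbb{E}\big[l_j\mathbb{I}\{\xi_j(u)=0\}\,\big|\,\mathcal{F}_{j-1}\big],$$ with $L_t(u)=0$ if $\sum_{i=1}^t\lambda_i(u)=0$.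
   Context: Setting. $\mathcal{X},\mathcal{Y}$ are measurable spaces; $f,\tilde f:\mathcal{X}\to\mathcal{Y}$ are fixed measurable maps ("thinking" and "non-thinking" model); $l:\mathcal{Y}\times\mathcal{Y}\to[0,1]$ is a measurable loss. $X_1,X_2,\dots$ are random elements of $\mathcal{X}$. Write $l_t=l(\tilde f(X_t),f(X_t))\in[0,1]$, and let $U_t\in[0,1]$ be the uncertainty score of $\tilde f(X_t)$, a measurable function of $X_t$. Fix a finite grid $\mathcal{U}=\{u^{(1)},\dots,u^{(N)}\}$ with $0=u^{(1)}<u^{(2)}<\dots<u^{(N)}=1$. The exploration probabilities $\rho_t$ are deterministic, and $\rho_{\min}=\inf_{t\ge1}\rho_t$. Procedure. Start with $\hat u_0=0$ and $K_0(u)=1$ for all $u\in\mathcal{U}$. At each time $t\ge1$: (1) $\pi_t=\mathbb{I}\{U_t\ge\hat u_{t-1}\}+\rho_t\mathbb{I}\{U_t<\hat u_{t-1}\}$. (2) Draw $\xi_t\in\{0,1\}$ which is Bernoulli$(\pi_t)$ conditionally on $\mathcal{F}_{t-1}$ and $X_t$, where $\mathcal{F}_t=\sigma(\{(X_i,\tilde f(X_i),l_i\xi_i,U_i)\}_{i=1}^t)$ ($\mathcal{F}_0$ trivial). (3) For $u\in\mathcal{U}$, $Z_t(u)=(1-\rho_{\min})\frac{l_t}{\pi_t}\xi_t\mathbb{I}\{U_t<u\}$ and $D_t(u)=\epsilon-Z_t(u)$. (4) $K_t(u)=K_{t-1}(u)\,(1+\lambda_t(u)D_t(u))$. (5) $\hat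 u_t$ is computed from $(K_t(u))_{u\in\mathcal{U}}$ by the rule in the claim. For fixed $u\in\mathcal{U}$, $\xi_j(u)$ denotes a random variable which, conditionally on $\mathcal{F}_{j-1}$ and $X_j$, is Bernoulli with parameter $\mathbb{I}\{U_j\ge u\}+\rho_j\mathbb{I}\{U_j<u\}$. $L_t(\hat u_t)$ means $L_t(u)$ evaluated at $u=\hat u_t$. *)

theory Defs
  imports "HOL-Probability.Probability"
begin

definition generated_by ::
  "'w measure \<Rightarrow> nat set \<Rightarrow> (nat \<Rightarrow> 'w \<Rightarrow> 'a) \<Rightarrow> 'a measure \<Rightarrow> 'w measure"
where
  "generated_by M I V N =
     sigma (space M) (\<Union>i\<in>I. {V i -` A \<inter> space M | A. A \<in> sets N})"

(* The sigma-algebra F_t: what has been observed up to time t.  The loss l_i is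
   only seen through l_i * xi_i, so F_t need not contain the sigma-algebra of xi_i.
   F_0 is trivial, since then the index set is empty. *)
definition obs_filtration ::
  "'w measure \<Rightarrow> 'x measure \<Rightarrow> 'y measure \<Rightarrow> ('x \<Rightarrow> 'y) \<Rightarrow> (nat \<Rightarrow> 'w \<Rightarrow> 'x) \<Rightarrow>
   (nat \<Rightarrow> 'w \<Rightarrow> real) \<Rightarrow> (nat \<Rightarrow> 'w \<Rightarrow> real) \<Rightarrow> (nat \<Rightarrow> 'w \<Rightarrow> real) \<Rightarrow> nat \<Rightarrow> 'w measure"
where
  "obs_filtration M MX MY ft X loss \<xi> U t =
     generated_by M {1..t} (\<lambda>i \<omega>. (X i \<omega>, ft (X i \<omega>), loss i \<omega> * \<xi> i \<omega>, U i \<omega>))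
       (MX \<Otimes>\<^sub>M MY \<Otimes>\<^sub>M borel \<Otimes>\<^sub>M borel)"

(* The sigma-algebra generated by G together with the random element Y. *)
definition adjoin :: "'w measure \<Rightarrow> ('w \<Rightarrow> 'a) \<Rightarrow> 'a measure \<Rightarrow> 'w measure" where
  "adjoin G Y N = sigma (space G) (sets G \<union> {Y -` A \<inter> space G | A. A \<in> sets N})"

(* xi is {0,1}-valued and P(xi = 1 | G) = p almost surely. *)
definition cond_bernoulli ::
  "'w measure \<Rightarrow> 'w measure \<Rightarrow> ('w \<Rightarrow> real) \<Rightarrow> ('w \<Rightarrow> real) \<Rightarrow> bool"
where
  "cond_bernoulli M G p \<xi> \<longleftrightarrow>
     \<xi> \<in> borel_measurable M \<and>
     (\<forall>\<omega>\<in>space M. \<xi> \<omega> \<in> {0, 1}) \<and>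
     (AE \<omega> in M. real_cond_exp M G (indicator {\<omega>'\<in>space M. \<xi> \<omega>' = 1}) \<omega> = p \<omega>)"

definition threshold ::
  "real set \<Rightarrow> (real \<Rightarrow> real) \<Rightarrow> real \<Rightarrow> (real \<Rightarrow> real) \<Rightarrow> real"
where
  "threshold \<U> \<nu> \<alpha> k =
     (let S = {u\<in>\<U>. k u \<ge> 1 / (\<alpha> * \<nu> u)} in if S = {} then 0 else Max S)"

(* L_t(u); \<xi>u j u stands for the variable xi_j(u). *)
definition weighted_risk ::
  "'w measure \<Rightarrow> (nat \<Rightarrow> 'w measure) \<Rightarrow> (nat \<Rightarrow> real \<Rightarrow> 'w \<Rightarrow> real) \<Rightarrow> (nat \<Rightarrow> 'w \<Rightarrow> real) \<Rightarrow>
   (nat \<Rightarrow> real \<Rightarrow> 'w \<Rightarrow> real) \<Rightarrow> nat \<Rightarrow> real \<Rightarrow> 'w \<Rightarrow> real"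
where
  "weighted_risk M F bet loss \<xi>u t u \<omega> =
     (if (\<Sum>i=1..t. bet i u \<omega>) = 0 then 0
      else (\<Sum>j=1..t. bet j u \<omega> / (\<Sum>i=1..t. bet i u \<omega>) *
              real_cond_exp M (F (j - 1))
                (\<lambda>\<omega>'. loss j \<omega>' * of_bool (\<xi>u j u \<omega>' = 0)) \<omega>))"

end

theory Submission
  imports Defs
begin

text \<open>
  Let \<open>m\<^sub>j(u)\<close> be the conditional risk at time \<open>j\<close>.  Importance weighting by \<open>1 / \<pi>\<^sub>j\<close> and
  \<open>\<rho>\<^sub>m\<^sub>i\<^sub>n \<le> \<rho>\<^sub>j\<close> give \<open>m\<^sub>j(u) \<le> E[Z\<^sub>j(u) | F\<^sub>j\<^sub>-\<^sub>1]\<close>, so by \<open>1 + x \<le> exp x\<close> the process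
  \<open>K\<^sub>t(u) exp (- \<Sum>\<^sub>j\<^sub>\<le>\<^sub>t \<lambda>\<^sub>j(u) (\<epsilon> - m\<^sub>j(u)))\<close> is a nonnegative supermartingale started at \<open>1\<close>.
  If the weighted risk at a threshold \<open>u > 0\<close> exceeds \<open>\<epsilon>\<close>, then the exponent is nonnegative and
  \<open>K\<^sub>t(u) \<ge> 1 / (\<alpha> \<nu>(u))\<close>, so the process reaches \<open>1 / (\<alpha> \<nu>(u))\<close>; by Ville's inequality this
  has probability at most \<open>\<alpha> \<nu>(u)\<close>.  Sum over the grid.  At the threshold \<open>0\<close> the conditional risk
  vanishes almost surely.
\<close>

lemma space_generated_by [simp]: "space (generated_by M I V N) = space M"
  by (simp add: generated_by_def space_measure_of_conv)

lemma sets_generated_by: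
  "sets (generated_by M I V N) =
     sigma_sets (space M) (\<Union>i\<in>I. {V i -` A \<inter> space M | A. A \<in> sets N})"
  unfolding generated_by_def by (rule sets_measure_of) auto

lemma measurable_generated_by:
  assumes "i \<in> I" "V i \<in> space M \<rightarrow> space N"
  shows "V i \<in> generated_by M I V N \<rightarrow>\<^sub>M N"
  using assms by (intro measurableI) (auto simp: sets_generated_by intro!: sigma_sets.Basic)

lemma subalgebra_generated_by:
  assumes "\<And>i. i \<in> I \<Longrightarrow> V i \<in> M \<rightarrow>\<^sub>M N"
  shows "subalgebra M (generated_by M I V N)"
proof -
  have "sigma_sets (space M) (\<Union>i\<in>I. {V i -` A \<inter> space M | A. A \<in> sets N}) \<subseteq> sets M"
    using assms by (intro sets.sigma_sets_subset) (auto intro: measurable_sets)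
  then show ?thesis
    by (simp add: subalgebra_def sets_generated_by)
qed

lemma generated_by_mono:
  assumes "I \<subseteq> J"
  shows "subalgebra (generated_by M J V N) (generated_by M I V N)"
proof -
  have "sigma_sets (space M) (\<Union>i\<in>I. {V i -` A \<inter> space M | A. A \<in> sets N})
      \<subseteq> sigma_sets (space M) (\<Union>i\<in>J. {V i -` A \<inter> space M | A. A \<in> sets N})"
    using assms by (intro sigma_sets_mono') blast
  then show ?thesis
    by (simp add: subalgebra_def sets_generated_by)
qed

lemma space_adjoin [simp]: "space (adjoin G Y N) = space G"
  by (simp add: adjoin_def space_measure_of_conv)

lemma sets_adjoin:
  "sets (adjoin G Y N) =
     sigma_sets (space G) (sets G \<union> {Y -` A \<inter> space G | A. A \<in> sets N})"
  unfolding adjoin_def by (rule sets_measure_of) (auto dest: sets.sets_into_space)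

lemma subalgebra_adjoin:
  assumes "subalgebra M G" "Y \<in> M \<rightarrow>\<^sub>M N"
  shows "subalgebra M (adjoin G Y N)"
proof -
  have G: "space G = space M" "sets G \<subseteq> sets M"
    using assms(1) by (auto simp: subalgebra_def)
  have "sigma_sets (space M) (sets G \<union> {Y -` A \<inter> space M | A. A \<in> sets N}) \<subseteq> sets M"
    using assms(2) G(2) by (intro sets.sigma_sets_subset) (auto intro: measurable_sets)
  then show ?thesis
    by (simp add: subalgebra_def sets_adjoin G(1))
qed

lemma subalgebra_adjoin_left: "subalgebra (adjoin G Y N) G"
  unfolding subalgebra_def sets_adjoin by auto

lemma measurable_adjoin:
  assumes "Y \<in> space G \<rightarrow> space N"
  shows "Y \<in> adjoin G Y N \<rightarrow>\<^sub>M N"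
  using assms by (intro measurableI) (auto simp: sets_adjoin intro!: sigma_sets.Basic)

text \<open>Freezing \<open>W\<close> when it first reaches level \<open>c\<close> keeps the
  expectation at most 1, and every path that has reached the level contributes at least
  \<open>c\<close>. Stating \<open>super\<close> through set integrals of \<open>ennreal\<close>
  values lets \<open>W\<close> be non-integrable.\<close>

lemma ville_inequality:
  fixes W :: "nat \<Rightarrow> 'w \<Rightarrow> ennreal"
  assumes "prob_space M"
    and sub: "\<And>n. subalgebra M (F n)"
    and mono: "\<And>m n. m \<le> n \<Longrightarrow> subalgebra (F n) (F m)"
    and adapted: "\<And>n. W n \<in> borel_measurable (F n)"
    and init: "(\<integral>\<^sup>+\<omega>. W 0 \<omega> \<partial>M) \<le> 1"
    and super: "\<And>n A. A \<in> sets (F n) \<Longrightarrow>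
      (\<integral>\<^sup>+\<omega>. W (Suc n) \<omega> * indicator A \<omega> \<partial>M) \<le> (\<integral>\<^sup>+\<omega>. W n \<omega> * indicator A \<omega> \<partial>M)"
  shows "c * emeasure M {\<omega>\<in>space M. \<exists>n. W n \<omega> \<ge> c} \<le> 1"
proof -
  interpret prob_space M by fact
  define B where "B n = {\<omega>\<in>space M. \<exists>k\<le>n. W k \<omega> \<ge> c}" for n
  have WF: "W k \<in> borel_measurable (F n)" if "k \<le> n" for k n
    by (rule measurable_from_subalg[OF mono[OF that] adapted])
  have W [measurable]: "W n \<in> borel_measurable M" for n
    by (rule measurable_from_subalg[OF sub adapted])
  have spF: "space (F n) = space M" for n
    using sub[of n] by (auto simp: subalgebra_def)
  have BM [measurable]: "B n \<in> sets M" for n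
    unfolding B_def by measurable
  \<comment> \<open>Not having reached \<open>c\<close> up to time \<open>n\<close> is an event of
    \<open>F n\<close>, because the earlier values of \<open>W\<close> are measurable there. Hence
    \<open>super\<close> can be applied on it.\<close>
  have CF: "space M - B n \<in> sets (F n)" for n
  proof -
    have "space M - B n = (\<Inter>k\<in>{..n}. {\<omega>\<in>space (F n). W k \<omega> < c})"
      unfolding B_def spF by (auto simp: not_le) (meson atMost_iff leD)
    also have "\<dots> \<in> sets (F n)"
      using WF by (intro sets.finite_INT) (auto intro!: borel_measurable_less)
    finally show ?thesis .
  qed
  have step: "c * emeasure M (B n) + (\<integral>\<^sup>+\<omega>. W n \<omega> * indicator (space M - B n) \<omega> \<partial>M) \<le> 1" for n
  proof (induction n)
    case 0
    have "c * emeasure M (B 0) + (\<integral>\<^sup>+\<omega>. W 0 \<omega> * indicator (space M - B 0) \<omega> \<partial>M) =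
        (\<integral>\<^sup>+\<omega>. c * indicator (B 0) \<omega> + W 0 \<omega> * indicator (space M - B 0) \<omega> \<partial>M)"
      by (subst nn_integral_add) (auto simp: nn_integral_cmult_indicator)
    also have "\<dots> \<le> (\<integral>\<^sup>+\<omega>. W 0 \<omega> \<partial>M)"
      by (intro nn_integral_mono) (auto simp: B_def indicator_def)
    finally show ?case using init by simp
  next
    case (Suc n)
    have "c * emeasure M (B (Suc n)) + (\<integral>\<^sup>+\<omega>. W (Suc n) \<omega> * indicator (space M - B (Suc n)) \<omega> \<partial>M) =
        (\<integral>\<^sup>+\<omega>. c * indicator (B (Suc n)) \<omega> + W (Suc n) \<omega> * indicator (space M - B (Suc n)) \<omega> \<partial>M)"
      by (subst nn_integral_add) (auto simp: nn_integral_cmult_indicator)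
    \<comment> \<open>A path in \<open>B (Suc n)\<close> but not in \<open>B n\<close> reaches the
      level exactly at time \<open>Suc n\<close>, so there \<open>c\<close> is bounded by
      \<open>W (Suc n)\<close>.\<close>
    also have "\<dots> \<le> (\<integral>\<^sup>+\<omega>. c * indicator (B n) \<omega> + W (Suc n) \<omega> * indicator (space M - B n) \<omega> \<partial>M)"
      by (intro nn_integral_mono) (auto simp: B_def indicator_def le_Suc_eq)
    also have "\<dots> = c * emeasure M (B n) + (\<integral>\<^sup>+\<omega>. W (Suc n) \<omega> * indicator (space M - B n) \<omega> \<partial>M)"
      by (subst nn_integral_add) (auto simp: nn_integral_cmult_indicator)
    also have "\<dots> \<le> c * emeasure M (B n) + (\<integral>\<^sup>+\<omega>. W n \<omega> * indicator (space M - B n) \<omega> \<partial>M)"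
      by (intro add_left_mono super CF)
    finally show ?case using Suc by simp
  qed
  have "c * emeasure M (B n) \<le> 1" for n
    by (rule order_trans[OF _ step[of n]]) simp
  \<comment> \<open>The bound is uniform in \<open>n\<close> and the events \<open>B n\<close>
    increase, so continuity from below extends it to the infinite horizon.\<close>
  then have "(SUP n. c * emeasure M (B n)) \<le> 1"
    by (rule SUP_least)
  moreover have "(SUP n. c * emeasure M (B n)) = c * (SUP n. emeasure M (B n))"
    by (simp add: SUP_mult_left_ennreal)
  moreover have "(SUP n. emeasure M (B n)) = emeasure M (\<Union>n. B n)"
    by (intro SUP_emeasure_incseq) (auto simp: incseq_def B_def intro: order_trans)
  moreover have "(\<Union>n. B n) = {\<omega>\<in>space M. \<exists>n. W n \<omega> \<ge> c}"
    by (auto simp: B_def)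
  ultimately show ?thesis by simp
qed

text \<open>Working with extended nonnegative conditional expectations makes the bound valid for bets
  that are unbounded and not even integrable.\<close>

lemma (in sigma_finite_subalgebra) cond_exp_wealth_factor_le:
  assumes b [measurable]: "b \<in> borel_measurable F" and b0: "\<And>\<omega>. \<omega> \<in> space M \<Longrightarrow> b \<omega> \<ge> 0"
    and Z: "integrable M Z" and Z0: "\<And>\<omega>. \<omega> \<in> space M \<Longrightarrow> Z \<omega> \<ge> 0"
    and nonneg: "\<And>\<omega>. \<omega> \<in> space M \<Longrightarrow> 1 + b \<omega> * (e - Z \<omega>) \<ge> 0" and e: "e \<ge> 0"
    and le: "AE \<omega> in M. m \<omega> \<le> real_cond_exp M F Z \<omega>"
  shows "AE \<omega> in M. nn_cond_exp M F (\<lambda>\<omega>. ennreal (1 + b \<omega> * (e - Z \<omega>))) \<omega>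
                    \<le> ennreal (exp (b \<omega> * (e - m \<omega>)))"
proof -
  have [measurable]: "Z \<in> borel_measurable M" using Z by auto
  have bM [measurable]: "b \<in> borel_measurable M"
    by (rule measurable_from_subalg[OF subalg b])
  let ?g = "nn_cond_exp M F (\<lambda>\<omega>. ennreal (1 + b \<omega> * (e - Z \<omega>)))"
  let ?z = "nn_cond_exp M F (\<lambda>\<omega>. ennreal (Z \<omega>))"
  have "AE \<omega> in M. ennreal (b \<omega>) * ?z \<omega> = nn_cond_exp M F (\<lambda>\<omega>. ennreal (b \<omega>) * ennreal (Z \<omega>)) \<omega>"
    by (rule nn_cond_exp_prod) auto
  \<comment> \<open>Adding \<open>b * Z\<close> back to the factor leaves \<open>1 + b * e\<close>,
    which is known given \<open>F\<close>. All terms are nonnegative, so additivity holds in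
    \<open>ennreal\<close> even if \<open>b * Z\<close> is not integrable; the factor is recovered
    below by subtraction.\<close>
  moreover have "AE \<omega> in M. ?g \<omega> + nn_cond_exp M F (\<lambda>\<omega>. ennreal (b \<omega>) * ennreal (Z \<omega>)) \<omega> =
      nn_cond_exp M F (\<lambda>\<omega>. ennreal (1 + b \<omega> * (e - Z \<omega>)) + ennreal (b \<omega>) * ennreal (Z \<omega>)) \<omega>"
    by (rule nn_cond_exp_sum) auto
  moreover have "AE \<omega> in M. nn_cond_exp M F (\<lambda>\<omega>. ennreal (1 + b \<omega> * (e - Z \<omega>)) + ennreal (b \<omega>) * ennreal (Z \<omega>)) \<omega>
      = nn_cond_exp M F (\<lambda>\<omega>. ennreal (1 + b \<omega> * e)) \<omega>"
  proof (rule nn_cond_exp_cong)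
    show "AE \<omega> in M. ennreal (1 + b \<omega> * (e - Z \<omega>)) + ennreal (b \<omega>) * ennreal (Z \<omega>) = ennreal (1 + b \<omega> * e)"
    proof (rule AE_I2)
      fix \<omega> assume w: "\<omega> \<in> space M"
      have "ennreal (1 + b \<omega> * (e - Z \<omega>)) + ennreal (b \<omega>) * ennreal (Z \<omega>) =
          ennreal (1 + b \<omega> * (e - Z \<omega>)) + ennreal (b \<omega> * Z \<omega>)"
        using b0[OF w] by (simp only: ennreal_mult')
      also have "\<dots> = ennreal ((1 + b \<omega> * (e - Z \<omega>)) + b \<omega> * Z \<omega>)"
        using b0[OF w] Z0[OF w] nonneg[OF w] by (intro ennreal_plus[symmetric] mult_nonneg_nonneg)
      also have "(1 + b \<omega> * (e - Z \<omega>)) + b \<omega> * Z \<omega> = 1 + b \<omega> * e"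
        by (simp add: algebra_simps)
      finally show "ennreal (1 + b \<omega> * (e - Z \<omega>)) + ennreal (b \<omega>) * ennreal (Z \<omega>) = ennreal (1 + b \<omega> * e)" .
    qed
  qed auto
  moreover have "AE \<omega> in M. ennreal (1 + b \<omega> * e) = nn_cond_exp M F (\<lambda>\<omega>. ennreal (1 + b \<omega> * e)) \<omega>"
    by (rule nn_cond_exp_F_meas) auto
  \<comment> \<open>Cancelling in \<open>ennreal\<close> requires a finite term; integrability of
    \<open>Z\<close> provides it.\<close>
  moreover have "AE \<omega> in M. ?z \<omega> \<noteq> \<infinity>"
  proof (rule nn_integral_PInf_AE)
    have "(\<integral>\<^sup>+\<omega>. ?z \<omega> \<partial>M) = (\<integral>\<^sup>+\<omega>. ennreal (Z \<omega>) \<partial>M)"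
      using nn_cond_exp_intg[of "\<lambda>_. 1" "\<lambda>\<omega>. ennreal (Z \<omega>)"] by simp
    also have "\<dots> = (\<integral>\<^sup>+\<omega>. ennreal (norm (Z \<omega>)) \<partial>M)"
      by (rule nn_integral_cong) (use Z0 in auto)
    also have "\<dots> < \<infinity>" using Z by (simp add: integrable_iff_bounded)
    finally show "(\<integral>\<^sup>+\<omega>. ?z \<omega> \<partial>M) \<noteq> \<infinity>" by simp
  qed auto
  moreover note le
  moreover have "AE \<omega> in M. \<omega> \<in> space M" by auto
  ultimately show ?thesis
  proof eventually_elim
    case (elim \<omega>)
    define r where "r = enn2real (?z \<omega>)"
    have z: "?z \<omega> = ennreal r" and r0: "r \<ge> 0"
      using elim(5) by (auto simp: r_def less_top)
    have mr: "m \<omega> \<le> r"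
    proof -
      \<comment> \<open>\<open>real_cond_exp\<close> is the conditional expectation of the positive
        part minus that of the negative part. The former is \<open>r\<close>, and dropping the
        latter gives the bound.\<close>
      have "real_cond_exp M F Z \<omega> \<le> r"
        by (simp add: real_cond_exp_def r_def)
      then show ?thesis using elim(6) by simp
    qed
    have b: "b \<omega> \<ge> 0" using elim b0 by auto
    have "?g \<omega> + ennreal (b \<omega> * r) = ennreal (1 + b \<omega> * e)"
      using elim(1-4) b by (metis z ennreal_mult')
    then have "?g \<omega> = ennreal (1 + b \<omega> * e) - ennreal (b \<omega> * r)"
      by (metis ennreal_add_diff_cancel_right ennreal_neq_top)
    also have "\<dots> = ennreal (1 + b \<omega> * (e - r))"
      using b r0 by (simp add: ennreal_minus algebra_simps)
    also have "\<dots> \<le> ennreal (exp (b \<omega> * (e - m \<omega>)))"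
    proof (rule ennreal_leI)
      have "1 + b \<omega> * (e - r) \<le> 1 + b \<omega> * (e - m \<omega>)"
        using b mr by (simp add: mult_left_mono)
      also have "\<dots> \<le> exp (b \<omega> * (e - m \<omega>))" by (rule exp_ge_add_one_self)
      finally show "1 + b \<omega> * (e - r) \<le> exp (b \<omega> * (e - m \<omega>))" .
    qed
    finally show ?case .
  qed
qed

text \<open>Conditioning first on the intermediate \<open>G\<close>, the factor \<open>g\<close>
  pulls out and \<open>p\<close> replaces \<open>\<xi>\<close>; the tower property then descends to
  \<open>F\<close>. In the theorem \<open>F\<close> is the past and \<open>G\<close> also contains
  the current input.\<close>

lemma (in sigma_finite_subalgebra) cond_exp_mult_bernoulli:
  assumes MG: "subalgebra M G" and GF: "subalgebra G F" and xi: "cond_bernoulli M G p \<xi>"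
    and g: "g \<in> borel_measurable G" and p: "p \<in> borel_measurable M"
    and int: "integrable M (\<lambda>\<omega>. g \<omega> * \<xi> \<omega>)"
  shows "AE \<omega> in M. real_cond_exp M F (\<lambda>\<omega>. g \<omega> * \<xi> \<omega>) \<omega> = real_cond_exp M F (\<lambda>\<omega>. g \<omega> * p \<omega>) \<omega>"
proof -
  interpret G: sigma_finite_subalgebra M G by (rule nested_subalg_is_sigma_finite[OF MG GF])
  \<comment> \<open>\<open>cond_bernoulli\<close> gives the conditional law through this indicator,
    which agrees with \<open>\<xi>\<close> on \<open>space M\<close>.\<close>
  define I :: "'a \<Rightarrow> real" where "I = indicator {\<omega>\<in>space M. \<xi> \<omega> = 1}"
  have [measurable]: "\<xi> \<in> borel_measurable M" and xi01: "\<And>\<omega>. \<omega> \<in> space M \<Longrightarrow> \<xi> \<omega> \<in> {0, 1}"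
    and xip: "AE \<omega> in M. real_cond_exp M G I \<omega> = p \<omega>"
    using xi unfolding cond_bernoulli_def I_def by blast+
  have gM [measurable]: "g \<in> borel_measurable M" by (rule measurable_from_subalg[OF MG g])
  note p [measurable]
  have I [measurable]: "I \<in> borel_measurable M" unfolding I_def by measurable
  have eq: "\<xi> \<omega> = I \<omega>" if "\<omega> \<in> space M" for \<omega>
    using xi01[OF that] that by (auto simp: I_def)
  have intI: "integrable M (\<lambda>\<omega>. g \<omega> * I \<omega>)"
    using int by (rule Bochner_Integration.integrable_cong[OF refl, THEN iffD1, rotated]) (simp add: eq)
  have 1: "AE \<omega> in M. real_cond_exp M F (\<lambda>\<omega>. g \<omega> * \<xi> \<omega>) \<omega> = real_cond_exp M F (\<lambda>\<omega>. g \<omega> * I \<omega>) \<omega>"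
    by (rule real_cond_exp_cong) (auto simp: eq)
  have 2: "AE \<omega> in M. real_cond_exp M F (real_cond_exp M G (\<lambda>\<omega>. g \<omega> * I \<omega>)) \<omega> =
      real_cond_exp M F (\<lambda>\<omega>. g \<omega> * I \<omega>) \<omega>"
    by (rule real_cond_exp_nested_subalg[OF MG GF intI])
  have "AE \<omega> in M. real_cond_exp M G (\<lambda>\<omega>. g \<omega> * I \<omega>) \<omega> = g \<omega> * real_cond_exp M G I \<omega>"
    by (rule G.real_cond_exp_mult[OF g I intI])
  with xip have "AE \<omega> in M. real_cond_exp M G (\<lambda>\<omega>. g \<omega> * I \<omega>) \<omega> = g \<omega> * p \<omega>"
    by eventually_elim simp
  then have 3: "AE \<omega> in M. real_cond_exp M F (real_cond_exp M G (\<lambda>\<omega>. g \<omega> * I \<omega>)) \<omega> =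
      real_cond_exp M F (\<lambda>\<omega>. g \<omega> * p \<omega>) \<omega>"
    by (rule real_cond_exp_cong) measurable
  from 1 2 3 show ?thesis by eventually_elim simp
qed

text \<open>The conditional expectation of the next wealth factor is at most the exponential of the
  next summand \<open>b j * (e - m j)\<close>. Dividing the wealth by the exponential of the
  accumulated sum therefore leaves a supermartingale, and on \<open>B\<close>, where the sum is
  nonpositive, this division cannot bring the wealth below \<open>c\<close>.\<close>

lemma wealth_ville:
  fixes F :: "nat \<Rightarrow> 'w measure"
  assumes "prob_space M"
    and sub: "\<And>n. subalgebra M (F n)"
    and mono: "\<And>m n. m \<le> n \<Longrightarrow> subalgebra (F n) (F m)"
    and b: "\<And>t. t \<ge> 1 \<Longrightarrow> b t \<in> borel_measurable (F (t - 1))"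
    and b0: "\<And>t \<omega>. t \<ge> 1 \<Longrightarrow> \<omega> \<in> space M \<Longrightarrow> b t \<omega> \<ge> 0"
    and Z: "\<And>t. t \<ge> 1 \<Longrightarrow> Z t \<in> borel_measurable (F t)" "\<And>t. t \<ge> 1 \<Longrightarrow> integrable M (Z t)"
    and Z0: "\<And>t \<omega>. t \<ge> 1 \<Longrightarrow> \<omega> \<in> space M \<Longrightarrow> Z t \<omega> \<ge> 0"
    and nonneg: "\<And>t \<omega>. t \<ge> 1 \<Longrightarrow> \<omega> \<in> space M \<Longrightarrow> 1 + b t \<omega> * (e - Z t \<omega>) \<ge> 0"
    and e: "e \<ge> 0"
    and m: "\<And>t. t \<ge> 1 \<Longrightarrow> m t \<in> borel_measurable (F (t - 1))"
    and le: "\<And>t. t \<ge> 1 \<Longrightarrow> AE \<omega> in M. m t \<omega> \<le> real_cond_exp M (F (t - 1)) (Z t) \<omega>"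
    and c: "c > 0"
  defines "B \<equiv> {\<omega>\<in>space M. \<exists>t. (\<Prod>j=1..t. 1 + b j \<omega> * (e - Z j \<omega>)) \<ge> c
           \<and> (\<Sum>j=1..t. b j \<omega> * (e - m j \<omega>)) \<le> 0}"
  shows "B \<in> sets M" "measure M B \<le> 1 / c"
proof -
  interpret prob_space M by fact
  let ?P = "\<lambda>t \<omega>. \<Prod>j=1..t. 1 + b j \<omega> * (e - Z j \<omega>)"
  let ?S = "\<lambda>t \<omega>. \<Sum>j=1..t. b j \<omega> * (e - m j \<omega>)"
  define W where "W t \<omega> = ennreal (?P t \<omega> * exp (- ?S t \<omega>))" for t \<omega>
  have up: "f \<in> borel_measurable (F t)" if "f \<in> borel_measurable (F s)" "s \<le> t" for f :: "'w \<Rightarrow> real" and s t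
    using measurable_from_subalg[OF mono[OF that(2)] that(1)] .
  have bF: "b j \<in> borel_measurable (F t)" if "j \<ge> 1" "j \<le> Suc t" for j t
    by (rule up[OF b]) (use that in auto)
  have mF: "m j \<in> borel_measurable (F t)" if "j \<ge> 1" "j \<le> Suc t" for j t
    by (rule up[OF m]) (use that in auto)
  have ZF: "Z j \<in> borel_measurable (F t)" if "j \<ge> 1" "j \<le> t" for j t
    by (rule up[OF Z(1)]) (use that in auto)
  have PF: "?P t \<in> borel_measurable (F t)" for t
    by (intro borel_measurable_prod borel_measurable_add borel_measurable_times
          borel_measurable_diff borel_measurable_const bF ZF) auto
  \<comment> \<open>Bets and risks of index \<open>j\<close> are known at time \<open>j - 1\<close>,
    so the sum up to \<open>Suc s\<close> is already known at time \<open>s\<close>.\<close>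
  have SF: "?S t \<in> borel_measurable (F s)" if "t \<le> Suc s" for t s
    by (intro borel_measurable_sum borel_measurable_times
          borel_measurable_diff borel_measurable_const bF mF) (use that in auto)
  have WF: "W t \<in> borel_measurable (F t)" for t
    unfolding W_def using PF[of t] SF[of t t] by measurable
  have fin: "finite_measure_subalgebra M (F t)" for t
    by unfold_locales (rule sub)
  have PM [measurable]: "?P t \<in> borel_measurable M" and SM [measurable]: "?S t \<in> borel_measurable M" for t
    using measurable_from_subalg[OF sub PF] measurable_from_subalg[OF sub SF[of t t]] by auto
  have P0: "?P t \<omega> \<ge> 0" if "\<omega> \<in> space M" for t \<omega>
    by (intro prod_nonneg ballI nonneg that) auto
  show "B \<in> sets M" unfolding B_def by measurable
  have "ennreal c * emeasure M {\<omega>\<in>space M. \<exists>t. W t \<omega> \<ge> ennreal c} \<le> 1"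
  proof (rule ville_inequality[OF assms(1) sub mono WF])
    show "(\<integral>\<^sup>+\<omega>. W 0 \<omega> \<partial>M) \<le> 1" by (simp add: W_def emeasure_space_1)
  next
    fix n A assume A: "A \<in> sets (F n)"
    interpret N: finite_measure_subalgebra M "F n" by (rule fin)
    \<comment> \<open>\<open>h\<close> collects everything in \<open>W (Suc n)\<close> that is known
      at time \<open>n\<close>; only the last wealth factor \<open>?f\<close> remains to be
      averaged.\<close>
    define h where "h \<omega> = ennreal (?P n \<omega> * exp (- ?S (Suc n) \<omega>)) * indicator A \<omega>" for \<omega>
    let ?f = "\<lambda>\<omega>. ennreal (1 + b (Suc n) \<omega> * (e - Z (Suc n) \<omega>))"
    have h: "h \<in> borel_measurable (F n)"
      unfolding h_def using PF[of n] SF[of "Suc n" n] A by measurable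
    have f: "?f \<in> borel_measurable M"
      by (intro measurable_compose[OF _ measurable_ennreal] borel_measurable_add borel_measurable_times
          borel_measurable_diff borel_measurable_const measurable_from_subalg[OF sub bF[of "Suc n" n]]
          borel_measurable_integrable[OF Z(2)]) auto
    have "(\<integral>\<^sup>+\<omega>. W (Suc n) \<omega> * indicator A \<omega> \<partial>M) = (\<integral>\<^sup>+\<omega>. h \<omega> * ?f \<omega> \<partial>M)"
    proof (rule nn_integral_cong)
      fix \<omega> assume w: "\<omega> \<in> space M"
      have "W (Suc n) \<omega> = ennreal ((?P n \<omega> * exp (- ?S (Suc n) \<omega>)) * (1 + b (Suc n) \<omega> * (e - Z (Suc n) \<omega>)))"
        unfolding W_def by (subst prod.nat_ivl_Suc') (auto simp: mult_ac)
      also have "\<dots> = ennreal (?P n \<omega> * exp (- ?S (Suc n) \<omega>)) * ?f \<omega>"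
        using P0[OF w, of n] by (intro ennreal_mult nonneg w mult_nonneg_nonneg) auto
      finally show "W (Suc n) \<omega> * indicator A \<omega> = h \<omega> * ?f \<omega>"
        by (simp add: h_def mult_ac)
    qed
    also have "\<dots> = (\<integral>\<^sup>+\<omega>. h \<omega> * nn_cond_exp M (F n) ?f \<omega> \<partial>M)"
      by (rule N.nn_cond_exp_intg[OF h f, symmetric])
    also have "\<dots> \<le> (\<integral>\<^sup>+\<omega>. W n \<omega> * indicator A \<omega> \<partial>M)"
    proof (rule nn_integral_mono_AE)
      have "AE \<omega> in M. nn_cond_exp M (F n) ?f \<omega> \<le> ennreal (exp (b (Suc n) \<omega> * (e - m (Suc n) \<omega>)))"
        by (rule N.cond_exp_wealth_factor_le)
          (use b[of "Suc n"] b0 Z Z0 nonneg e le[of "Suc n"] in auto)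
      moreover have "AE \<omega> in M. \<omega> \<in> space M" by auto
      ultimately show "AE \<omega> in M. h \<omega> * nn_cond_exp M (F n) ?f \<omega> \<le> W n \<omega> * indicator A \<omega>"
      proof eventually_elim
        case (elim \<omega>)
        have "h \<omega> * nn_cond_exp M (F n) ?f \<omega> \<le> h \<omega> * ennreal (exp (b (Suc n) \<omega> * (e - m (Suc n) \<omega>)))"
          by (intro mult_left_mono elim) auto
        also have "\<dots> = ennreal (?P n \<omega> * exp (- ?S (Suc n) \<omega>)) * ennreal (exp (b (Suc n) \<omega> * (e - m (Suc n) \<omega>))) * indicator A \<omega>"
          by (simp add: h_def mult_ac)
        also have "ennreal (?P n \<omega> * exp (- ?S (Suc n) \<omega>)) * ennreal (exp (b (Suc n) \<omega> * (e - m (Suc n) \<omega>)))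
            = ennreal (?P n \<omega> * (exp (- ?S (Suc n) \<omega>) * exp (b (Suc n) \<omega> * (e - m (Suc n) \<omega>))))"
          using P0[OF elim(2), of n] by (simp add: ennreal_mult'[symmetric] mult.assoc)
        \<comment> \<open>The exponential bound on the factor cancels the last summand of
          \<open>?S (Suc n)\<close>.\<close>
        also have "\<dots> = W n \<omega>"
          unfolding W_def exp_add[symmetric] by (subst sum.nat_ivl_Suc') auto
        finally show ?case .
      qed
    qed
    finally show "(\<integral>\<^sup>+\<omega>. W (Suc n) \<omega> * indicator A \<omega> \<partial>M) \<le> (\<integral>\<^sup>+\<omega>. W n \<omega> * indicator A \<omega> \<partial>M)" .
  qed
  moreover have "emeasure M B
      \<le> emeasure M {\<omega>\<in>space M. \<exists>t. W t \<omega> \<ge> ennreal c}"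
  proof (rule emeasure_mono)
    show "B \<subseteq> {\<omega>\<in>space M. \<exists>t. W t \<omega> \<ge> ennreal c}"
    unfolding B_def
    proof safe
      fix \<omega> t assume w: "\<omega> \<in> space M" and *: "?P t \<omega> \<ge> c" "?S t \<omega> \<le> 0"
      \<comment> \<open>A nonpositive \<open>?S\<close> makes the exponential at least 1, so the
        level reached by the wealth is also reached by \<open>W\<close>.\<close>
      have "c * 1 \<le> ?P t \<omega> * exp (- ?S t \<omega>)"
        using * P0[OF w, of t] by (intro mult_mono) auto
      then show "\<exists>t. ennreal c \<le> W t \<omega>"
        unfolding W_def by (intro exI[of _ t] ennreal_leI) simp
    qed
    have [measurable]: "W t \<in> borel_measurable M" for t
      by (rule measurable_from_subalg[OF sub WF])
    show "{\<omega>\<in>space M. \<exists>t. W t \<omega> \<ge> ennreal c} \<in> sets M" by measurable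
  qed
  ultimately have "ennreal c * emeasure M B \<le> 1"
    by (meson mult_left_mono order_trans zero_le)
  then have "ennreal (c * measure M B) \<le> ennreal 1"
    using c by (simp add: emeasure_eq_measure ennreal_mult')
  then have "c * measure M B \<le> 1"
    by (subst (asm) ennreal_le_iff) auto
  then show "measure M B \<le> 1 / c" using c by (simp add: field_simps)
qed

lemma borel_measurable_threshold:
  assumes "finite \<U>" and k: "\<And>u. u \<in> \<U> \<Longrightarrow> k u \<in> borel_measurable N"
  shows "(\<lambda>\<omega>. threshold \<U> \<nu> \<alpha> (\<lambda>u. k u \<omega>)) \<in> borel_measurable N"
proof (unfold borel_measurable_iff_le, rule allI)
  fix a
  let ?c = "\<lambda>u. 1 / (\<alpha> * \<nu> u)"
  have *: "{\<omega>\<in>space N. ?c u \<le> k u \<omega>} \<in> sets N" if "u \<in> \<U>" for u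
    using k[OF that] by measurable
  \<comment> \<open>A maximum is at most \<open>a\<close> iff every member is. If no grid point
    qualifies, the value is the default 0, hence the separate condition
    \<open>0 \<le> a\<close>.\<close>
  have "threshold \<U> \<nu> \<alpha> (\<lambda>u. k u \<omega>) \<le> a \<longleftrightarrow>
      ((\<forall>u\<in>\<U>. \<not> ?c u \<le> k u \<omega>) \<longrightarrow> 0 \<le> a) \<and> (\<forall>u\<in>\<U>. ?c u \<le> k u \<omega> \<longrightarrow> u \<le> a)" for \<omega>
    using \<open>finite \<U>\<close> by (auto simp: threshold_def Let_def)
  then have "{\<omega>\<in>space N. threshold \<U> \<nu> \<alpha> (\<lambda>u. k u \<omega>) \<le> a} =
      {\<omega>\<in>space N. ((\<forall>u\<in>\<U>. \<not> ?c u \<le> k u \<omega>) \<longrightarrow> 0 \<le> a) \<and> (\<forall>u\<in>\<U>. ?c u \<le> k u \<omega> \<longrightarrow> u \<le> a)}"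
    by simp
  also have "\<dots> \<in> sets N"
    using * \<open>finite \<U>\<close>
    by (intro sets.sets_Collect_conj sets.sets_Collect_imp sets.sets_Collect_finite_All
          sets.sets_Collect_neg sets.sets_Collect_const)
  finally show "{\<omega>\<in>space N. threshold \<U> \<nu> \<alpha> (\<lambda>u. k u \<omega>) \<le> a} \<in> sets N" .
qed

text \<open>The value 0 may be the default for the empty set and then says nothing about the wealth;
  a nonzero value was selected, so the wealth has passed its level there.\<close>

lemma threshold_cases:
  assumes "finite \<U>"
  obtains "threshold \<U> \<nu> \<alpha> k = 0"
  | "threshold \<U> \<nu> \<alpha> k \<in> \<U>"
    "k (threshold \<U> \<nu> \<alpha> k) \<ge> 1 / (\<alpha> * \<nu> (threshold \<U> \<nu> \<alpha> k))"
proof (cases "{u\<in>\<U>. k u \<ge> 1 / (\<alpha> * \<nu> u)} = {}")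
  case True
  then show ?thesis using that(1) by (simp add: threshold_def Let_def)
next
  case False
  then have "threshold \<U> \<nu> \<alpha> k = Max {u\<in>\<U>. k u \<ge> 1 / (\<alpha> * \<nu> u)}"
    unfolding threshold_def Let_def by (rule if_not_P)
  also have "\<dots> \<in> {u\<in>\<U>. k u \<ge> 1 / (\<alpha> * \<nu> u)}"
    using assms False by (intro Max_in) auto
  finally show ?thesis using that(2) by blast
qed

text \<open>Multiplying by the positive total bet removes the random normalisation. A risk violation
  thus becomes the sign condition in the event of \<open>wealth_ville\<close>.\<close>

lemma weighted_risk_gt_imp:
  assumes b: "\<And>j. j \<in> {1..t} \<Longrightarrow> bet j u \<omega> \<ge> 0" and "e \<ge> 0"
    and gt: "weighted_risk M F bet loss \<xi>u t u \<omega> > e"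
  shows "(\<Sum>j=1..t. bet j u \<omega> * (e - real_cond_exp M (F (j - 1))
            (\<lambda>\<omega>'. loss j \<omega>' * of_bool (\<xi>u j u \<omega>' = 0)) \<omega>)) \<le> 0"
proof -
  let ?m = "\<lambda>j. real_cond_exp M (F (j - 1)) (\<lambda>\<omega>'. loss j \<omega>' * of_bool (\<xi>u j u \<omega>' = 0)) \<omega>"
  let ?S = "\<Sum>i=1..t. bet i u \<omega>"
  \<comment> \<open>With total bet 0 the risk is 0 by convention and cannot exceed
    \<open>e\<close>.\<close>
  have "?S \<noteq> 0" using gt \<open>e \<ge> 0\<close> by (auto simp: weighted_risk_def split: if_splits)
  moreover have "?S \<ge> 0" by (rule sum_nonneg) (use b in auto)
  ultimately have S: "?S > 0" by simp
  have "e < (\<Sum>j=1..t. bet j u \<omega> / ?S * ?m j)"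
    using gt \<open>?S \<noteq> 0\<close> by (simp add: weighted_risk_def)
  also have "\<dots> = (\<Sum>j=1..t. bet j u \<omega> * ?m j) / ?S"
    by (simp add: sum_divide_distrib)
  finally have "e * ?S < (\<Sum>j=1..t. bet j u \<omega> * ?m j)"
    using S by (simp add: pos_less_divide_eq)
  then show ?thesis
    by (simp add: right_diff_distrib sum_subtractf sum_distrib_left mult.commute)
qed

text \<open>This serves threshold 0, which can be the default value without any lower bound on the
  wealth.\<close>

lemma weighted_risk_nonpos:
  assumes b: "\<And>j. j \<in> {1..t} \<Longrightarrow> bet j u \<omega> \<ge> 0"
    and m: "\<And>j. j \<in> {1..t} \<Longrightarrow> real_cond_exp M (F (j - 1))
            (\<lambda>\<omega>'. loss j \<omega>' * of_bool (\<xi>u j u \<omega>' = 0)) \<omega> \<le> 0"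
  shows "weighted_risk M F bet loss \<xi>u t u \<omega> \<le> 0"
  unfolding weighted_risk_def using b m
  by (auto intro!: sum_nonpos divide_nonpos_nonneg mult_nonneg_nonpos sum_nonneg)

lemma borel_measurable_weighted_risk:
  assumes b: "\<And>j. j \<in> {1..t} \<Longrightarrow> bet j u \<in> borel_measurable M"
  shows "weighted_risk M F bet loss \<xi>u t u \<in> borel_measurable M"
proof -
  have S [measurable]: "(\<lambda>\<omega>. \<Sum>i=1..t. bet i u \<omega>) \<in> borel_measurable M"
    by (rule borel_measurable_sum) (rule b)
  have "(\<lambda>\<omega>. \<Sum>j=1..t. bet j u \<omega> / (\<Sum>i=1..t. bet i u \<omega>) *
      real_cond_exp M (F (j - 1)) (\<lambda>\<omega>'. loss j \<omega>' * of_bool (\<xi>u j u \<omega>' = 0)) \<omega>) \<in> borel_measurable M"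
    by (intro borel_measurable_sum borel_measurable_times borel_measurable_divide b S
          borel_measurable_cond_exp2)
  then show ?thesis
    unfolding weighted_risk_def[abs_def] by measurable
qed


theorem theorem5p1:
  fixes M :: "'w measure" and MX :: "'x measure" and MY :: "'y measure"
    and f ft :: "'x \<Rightarrow> 'y" and l :: "'y \<times> 'y \<Rightarrow> real"
    and X :: "nat \<Rightarrow> 'w \<Rightarrow> 'x" and U loss \<xi> p :: "nat \<Rightarrow> 'w \<Rightarrow> real"
    and \<U> :: "real set" and \<nu> :: "real \<Rightarrow> real" and \<alpha> \<epsilon> :: real and \<rho> :: "nat \<Rightarrow> real"
    and bet \<xi>u Z D K :: "nat \<Rightarrow> real \<Rightarrow> 'w \<Rightarrow> real"
    and uhat :: "nat \<Rightarrow> 'w \<Rightarrow> real"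
    and F :: "nat \<Rightarrow> 'w measure"
  assumes "prob_space M"
    and "f \<in> MX \<rightarrow>\<^sub>M MY" and "ft \<in> MX \<rightarrow>\<^sub>M MY"
    and "l \<in> borel_measurable (MY \<Otimes>\<^sub>M MY)"
    and "\<And>y y'. y \<in> space MY \<Longrightarrow> y' \<in> space MY \<Longrightarrow> l (y, y') \<in> {0..1}"
    and "\<And>t. t \<ge> 1 \<Longrightarrow> X t \<in> M \<rightarrow>\<^sub>M MX"
    and loss: "\<And>t \<omega>. t \<ge> 1 \<Longrightarrow> \<omega> \<in> space M \<Longrightarrow> loss t \<omega> = l (ft (X t \<omega>), f (X t \<omega>))"
    and score: "\<And>t. t \<ge> 1 \<Longrightarrow> \<exists>s \<in> borel_measurable MX. \<forall>\<omega>\<in>space M. U t \<omega> = s (X t \<omega>)"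
    and "\<And>t \<omega>. t \<ge> 1 \<Longrightarrow> \<omega> \<in> space M \<Longrightarrow> U t \<omega> \<in> {0..1}"
    and grid: "finite \<U>" "\<U> \<subseteq> {0..1}" "0 \<in> \<U>" "1 \<in> \<U>"
    and prior: "\<And>u. u \<in> \<U> \<Longrightarrow> \<nu> u \<in> {0<..1}" "(\<Sum>u\<in>\<U>. \<nu> u) = 1"
    and "\<alpha> \<in> {0<..<1}" and "\<epsilon> \<in> {0<..<1}"
    and "\<And>t. t \<ge> 1 \<Longrightarrow> \<rho> t \<in> {0<..<1}"
    and filtration: "\<And>t. F t = obs_filtration M MX MY ft X loss \<xi> U t"
    and uhat_0: "\<And>\<omega>. \<omega> \<in> space M \<Longrightarrow> uhat 0 \<omega> = 0"
    and K_0: "\<And>u \<omega>. u \<in> \<U> \<Longrightarrow> \<omega> \<in> space M \<Longrightarrow> K 0 u \<omega> = 1"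
    and step1: "\<And>t \<omega>. t \<ge> 1 \<Longrightarrow> \<omega> \<in> space M \<Longrightarrow>
      p t \<omega> = of_bool (U t \<omega> \<ge> uhat (t - 1) \<omega>) + \<rho> t * of_bool (U t \<omega> < uhat (t - 1) \<omega>)"
    and step2: "\<And>t. t \<ge> 1 \<Longrightarrow> cond_bernoulli M (adjoin (F (t - 1)) (X t) MX) (p t) (\<xi> t)"
    and step3: "\<And>t u \<omega>. t \<ge> 1 \<Longrightarrow> u \<in> \<U> \<Longrightarrow> \<omega> \<in> space M \<Longrightarrow>
      Z t u \<omega> = (1 - (INF s\<in>{1..}. \<rho> s)) * (loss t \<omega> / p t \<omega>) * \<xi> t \<omega> * of_bool (U t \<omega> < u)"
      "\<And>t u \<omega>. t \<ge> 1 \<Longrightarrow> u \<in> \<U> \<Longrightarrow> \<omega> \<in> space M \<Longrightarrow> D t u \<omega> = \<epsilon> - Z t u \<omega>"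
    and step4: "\<And>t u \<omega>. t \<ge> 1 \<Longrightarrow> u \<in> \<U> \<Longrightarrow> \<omega> \<in> space M \<Longrightarrow>
      K t u \<omega> = K (t - 1) u \<omega> * (1 + bet t u \<omega> * D t u \<omega>)"
    and step5: "\<And>t \<omega>. t \<ge> 1 \<Longrightarrow> \<omega> \<in> space M \<Longrightarrow>
      uhat t \<omega> = threshold \<U> \<nu> \<alpha> (\<lambda>u. K t u \<omega>)"
    and bets: "\<And>t u. t \<ge> 1 \<Longrightarrow> u \<in> \<U> \<Longrightarrow> bet t u \<in> borel_measurable (F (t - 1))"
      "\<And>t u \<omega>. t \<ge> 1 \<Longrightarrow> u \<in> \<U> \<Longrightarrow> \<omega> \<in> space M \<Longrightarrow> bet t u \<omega> \<ge> 0"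
      "\<And>t u \<omega>. t \<ge> 1 \<Longrightarrow> u \<in> \<U> \<Longrightarrow> \<omega> \<in> space M \<Longrightarrow> 1 + bet t u \<omega> * D t u \<omega> \<ge> 0"
    and xi_u: "\<And>j u. j \<ge> 1 \<Longrightarrow> u \<in> \<U> \<Longrightarrow>
      cond_bernoulli M (adjoin (F (j - 1)) (X j) MX)
        (\<lambda>\<omega>. of_bool (U j \<omega> \<ge> u) + \<rho> j * of_bool (U j \<omega> < u)) (\<xi>u j u)"
  shows "measure M {\<omega>\<in>space M. \<forall>t\<ge>1. weighted_risk M F bet loss \<xi>u t (uhat t \<omega>) \<omega> \<le> \<epsilon>} \<ge> 1 - \<alpha>"
proof -
  interpret prob_space M by fact
  note l01 = assms(5) and X = assms(6) and U01 = assms(9) and \<alpha> = assms(16) and \<epsilon> = assms(17)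
    and \<rho> = assms(18)
  note [measurable] = assms(2-4)

  \<comment> \<open>The observed filtration and the measurability of losses and scores\<close>
  define V where "V = (\<lambda>i \<omega>. (X i \<omega>, ft (X i \<omega>), loss i \<omega> * \<xi> i \<omega>, U i \<omega>))"
  define N where "N = MX \<Otimes>\<^sub>M MY \<Otimes>\<^sub>M (borel :: real measure) \<Otimes>\<^sub>M (borel :: real measure)"
  have F: "F t = generated_by M {1..t} V N" for t
    by (simp add: filtration obs_filtration_def V_def N_def)
  \<comment> \<open>\<open>G t\<close> is the information available when \<open>\<xi> t\<close> is
    drawn: the past and the current input.\<close>
  define G where "G t = adjoin (F (t - 1)) (X t) MX" for t
  define r where "r = (INF s\<in>{1..}. \<rho> s)"
  have spF [simp]: "space (F t) = space M" for t by (simp add: F)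
  have spG [simp]: "space (G t) = space M" for t by (simp add: G_def)

  have \<xi>M: "\<xi> t \<in> borel_measurable M" and \<xi>01: "\<And>\<omega>. \<omega> \<in> space M \<Longrightarrow> \<xi> t \<omega> \<in> {0, 1}"
    if "t \<ge> 1" for t
    using step2[OF that] by (auto simp: cond_bernoulli_def)
  have \<xi>uM: "\<xi>u t u \<in> borel_measurable M" and \<xi>u01: "\<And>\<omega>. \<omega> \<in> space M \<Longrightarrow> \<xi>u t u \<omega> \<in> {0, 1}"
    if "t \<ge> 1" "u \<in> \<U>" for t u
    using xi_u[OF that] by (auto simp: cond_bernoulli_def)

  \<comment> \<open>A generic \<open>A\<close> making \<open>X t\<close> measurable covers both
    \<open>M\<close> and \<open>G t\<close>; for the scores below it also covers
    \<open>F t\<close>.\<close>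
  have lossA: "loss t \<in> borel_measurable A" if "t \<ge> 1" "X t \<in> A \<rightarrow>\<^sub>M MX" "space A = space M" for t A
  proof -
    note [measurable] = that(2)
    have "(\<lambda>\<omega>. l (ft (X t \<omega>), f (X t \<omega>))) \<in> borel_measurable A" by measurable
    then show ?thesis
      by (rule measurable_cong[THEN iffD2, rotated]) (simp add: loss[OF that(1)] that(3))
  qed
  have UA: "U t \<in> borel_measurable A" if "t \<ge> 1" "X t \<in> A \<rightarrow>\<^sub>M MX" "space A = space M" for t A
  proof -
    note [measurable] = that(2)
    obtain s where [measurable]: "s \<in> borel_measurable MX" and s: "\<forall>\<omega>\<in>space M. U t \<omega> = s (X t \<omega>)"
      using score[OF \<open>t \<ge> 1\<close>] by blast
    have "(\<lambda>\<omega>. s (X t \<omega>)) \<in> borel_measurable A" by measurable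
    then show ?thesis
      by (rule measurable_cong[THEN iffD2, rotated]) (simp add: s that(3))
  qed
  have lossM: "loss t \<in> borel_measurable M" and UM: "U t \<in> borel_measurable M" if "t \<ge> 1" for t
    using that lossA UA X by auto
  have VM: "V i \<in> M \<rightarrow>\<^sub>M N" if "i \<ge> 1" for i
  proof -
    note [measurable] = X[OF that] lossM[OF that] UM[OF that] \<xi>M[OF that]
    show ?thesis unfolding V_def N_def by measurable
  qed
  have sub: "subalgebra M (F t)" for t
    unfolding F by (rule subalgebra_generated_by) (auto intro: VM)
  have mono: "subalgebra (F t) (F s)" if "s \<le> t" for s t
    unfolding F by (rule generated_by_mono) (use that in auto)
  have up: "h \<in> borel_measurable (F t)" if "h \<in> borel_measurable (F s)" "s \<le> t"
    for h :: "'w \<Rightarrow> real" and s t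
    by (rule measurable_from_subalg[OF mono[OF that(2)] that(1)])
  have subG: "subalgebra M (G t)" if "t \<ge> 1" for t
    unfolding G_def by (rule subalgebra_adjoin[OF sub X[OF that]])
  have GF: "subalgebra (G t) (F (t - 1))" for t
    unfolding G_def by (rule subalgebra_adjoin_left)
  have fin: "finite_measure_subalgebra M (F t)" for t
    by unfold_locales (rule sub)

  have VF: "V i \<in> F i \<rightarrow>\<^sub>M N" if "i \<ge> 1" for i
    unfolding F by (rule measurable_generated_by) (use that measurable_space[OF VM] in auto)
  have XF: "X t \<in> F t \<rightarrow>\<^sub>M MX" and l\<xi>F: "(\<lambda>\<omega>. loss t \<omega> * \<xi> t \<omega>) \<in> borel_measurable (F t)"
    if "t \<ge> 1" for t
  proof -
    note VF[OF that, unfolded N_def, measurable]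
    have "(\<lambda>\<omega>. fst (V t \<omega>)) \<in> F t \<rightarrow>\<^sub>M MX" by measurable
    then show "X t \<in> F t \<rightarrow>\<^sub>M MX" by (simp add: V_def)
    have "(\<lambda>\<omega>. fst (snd (snd (V t \<omega>)))) \<in> borel_measurable (F t)" by measurable
    then show "(\<lambda>\<omega>. loss t \<omega> * \<xi> t \<omega>) \<in> borel_measurable (F t)" by (simp add: V_def)
  qed
  have UF: "U t \<in> borel_measurable (F t)" if "t \<ge> 1" for t
    by (rule UA[OF that XF[OF that]]) simp
  have XG: "X t \<in> G t \<rightarrow>\<^sub>M MX" if "t \<ge> 1" for t
    unfolding G_def by (rule measurable_adjoin) (use measurable_space[OF X[OF that]] in auto)
  have lossG: "loss t \<in> borel_measurable (G t)" and UG: "U t \<in> borel_measurable (G t)" if "t \<ge> 1" for t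
    using that lossA UA XG by auto

  \<comment> \<open>Adaptedness of the procedure\<close>
  have pA: "p t \<in> borel_measurable A"
    if "t \<ge> 1" "uhat (t - 1) \<in> borel_measurable A" "U t \<in> borel_measurable A" "space A = space M" for t A
  proof -
    note [measurable] = that(2,3)
    have "(\<lambda>\<omega>. of_bool (U t \<omega> \<ge> uhat (t - 1) \<omega>) + \<rho> t * of_bool (U t \<omega> < uhat (t - 1) \<omega>))
        \<in> borel_measurable A"
      by measurable
    then show ?thesis
      by (rule measurable_cong[THEN iffD2, rotated]) (simp add: step1[OF that(1)] that(4))
  qed
  \<comment> \<open>\<open>\<xi> t\<close> alone need not be measurable for \<open>F t\<close>, as
    it is hidden where the loss vanishes. The requirement is therefore put on the product through
    which it enters \<open>Z\<close>.\<close>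
  have ZA: "Z t u \<in> borel_measurable A"
    if "t \<ge> 1" "u \<in> \<U>" "p t \<in> borel_measurable A" "U t \<in> borel_measurable A"
      "(\<lambda>\<omega>. loss t \<omega> * \<xi> t \<omega>) \<in> borel_measurable A" "space A = space M" for t u A
  proof -
    note [measurable] = that(3-5)
    have "(\<lambda>\<omega>. (1 - r) * (loss t \<omega> * \<xi> t \<omega>) / p t \<omega> * of_bool (U t \<omega> < u)) \<in> borel_measurable A"
      by measurable
    then show ?thesis
      by (rule measurable_cong[THEN iffD2, rotated]) (simp add: step3(1)[OF that(1,2)] that(6) r_def)
  qed
  \<comment> \<open>Wealth and threshold need a joint induction: the old threshold determines
    \<open>p\<close>, which enters \<open>Z\<close>, then the new wealth, then the new
    threshold.\<close>
  have Kuhat: "(\<forall>u\<in>\<U>. K t u \<in> borel_measurable (F t)) \<and> uhat t \<in> borel_measurable (F t)" for t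
  proof (induction t)
    case 0
    have "K 0 u \<in> borel_measurable (F 0)" if "u \<in> \<U>" for u
      using that by (subst measurable_cong[of _ _ "\<lambda>_. 1"]) (auto simp: K_0)
    moreover have "uhat 0 \<in> borel_measurable (F 0)"
      by (subst measurable_cong[of _ _ "\<lambda>_. 0"]) (auto simp: uhat_0)
    ultimately show ?case by blast
  next
    case (Suc t)
    have p: "p (Suc t) \<in> borel_measurable (F (Suc t))"
      by (rule pA[OF _ up[of _ t] UF]) (simp_all add: Suc)
    have K: "K (Suc t) u \<in> borel_measurable (F (Suc t))" if u: "u \<in> \<U>" for u
    proof -
      have [measurable]: "Z (Suc t) u \<in> borel_measurable (F (Suc t))"
        by (rule ZA[OF _ u p UF l\<xi>F]) simp_all
      have [measurable]: "K t u \<in> borel_measurable (F (Suc t))"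
        by (rule up[of _ t]) (simp_all add: Suc u)
      have [measurable]: "bet (Suc t) u \<in> borel_measurable (F (Suc t))"
        by (rule up[OF bets(1)]) (simp_all add: u)
      have "(\<lambda>\<omega>. K t u \<omega> * (1 + bet (Suc t) u \<omega> * (\<epsilon> - Z (Suc t) u \<omega>))) \<in> borel_measurable (F (Suc t))"
        by measurable
      then show ?thesis
        by (rule measurable_cong[THEN iffD2, rotated]) (simp add: u step4[of "Suc t"] step3(2)[of "Suc t"])
    qed
    have "(\<lambda>\<omega>. threshold \<U> \<nu> \<alpha> (\<lambda>u. K (Suc t) u \<omega>)) \<in> borel_measurable (F (Suc t))"
      by (rule borel_measurable_threshold[OF grid(1) K])
    then have "uhat (Suc t) \<in> borel_measurable (F (Suc t))"
      by (rule measurable_cong[THEN iffD2, rotated]) (simp add: step5)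
    with K show ?case by blast
  qed
  have uhatF: "uhat t \<in> borel_measurable (F t)" for t using Kuhat by blast
  have pF: "p t \<in> borel_measurable (F t)" if "t \<ge> 1" for t
    by (rule pA[OF that up[OF uhatF] UF[OF that]]) simp_all
  \<comment> \<open>\<open>p t\<close> is fixed before \<open>\<xi> t\<close> is drawn, so the
    importance weight can be pulled out of the expectation given \<open>G t\<close>.\<close>
  have pG: "p t \<in> borel_measurable (G t)" if "t \<ge> 1" for t
    by (rule pA[OF that measurable_from_subalg[OF GF uhatF] UG[OF that]]) simp
  have ZF: "Z t u \<in> borel_measurable (F t)" if "t \<ge> 1" "u \<in> \<U>" for t u
    by (rule ZA[OF that pF[OF that(1)] UF[OF that(1)] l\<xi>F[OF that(1)] spF])

  \<comment> \<open>Bounds and integrability of the importance-weighted losses\<close>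
  have loss01: "0 \<le> loss t \<omega>" "loss t \<omega> \<le> 1" if "t \<ge> 1" "\<omega> \<in> space M" for t \<omega>
  proof -
    have "X t \<omega> \<in> space MX" using X that by (auto intro: measurable_space)
    then have "l (ft (X t \<omega>), f (X t \<omega>)) \<in> {0..1}"
      by (intro l01 measurable_space[OF assms(2)] measurable_space[OF assms(3)])
    then show "0 \<le> loss t \<omega>" "loss t \<omega> \<le> 1" using loss that by auto
  qed
  have p_ge: "\<rho> t \<le> p t \<omega>" if "t \<ge> 1" "\<omega> \<in> space M" for t \<omega>
    using \<rho>[OF that(1)] by (simp add: step1[OF that])
  have p_pos: "0 < p t \<omega>" if "t \<ge> 1" "\<omega> \<in> space M" for t \<omega>
    using \<rho>[OF that(1)] p_ge[OF that] by simp
  have r_le: "r \<le> \<rho> t" if "t \<ge> 1" for t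
    unfolding r_def using that \<rho> by (intro cINF_lower bdd_belowI[of _ 0]) (auto intro: less_imp_le)
  have r0: "0 \<le> r"
    unfolding r_def using \<rho> by (intro cINF_greatest) (auto intro: less_imp_le)
  have r1: "r < 1" using r_le[of 1] \<rho>[of 1] by simp

  \<comment> \<open>The bound uses the individual \<open>\<rho> t\<close>, which is positive,
    because the infimum \<open>r\<close> may be 0.\<close>
  have Z0: "0 \<le> Z t u \<omega>" and Z1: "Z t u \<omega> \<le> 1 / \<rho> t" if "t \<ge> 1" "u \<in> \<U>" "\<omega> \<in> space M" for t u \<omega>
  proof -
    have Z: "Z t u \<omega> = (1 - r) * (loss t \<omega> / p t \<omega>) * \<xi> t \<omega> * of_bool (U t \<omega> < u)"
      using step3(1)[OF that] by (simp add: r_def)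
    have *: "0 \<le> loss t \<omega> / p t \<omega>" "loss t \<omega> / p t \<omega> \<le> 1 / \<rho> t" "0 \<le> 1 / \<rho> t"
      using loss01[OF that(1,3)] p_ge[OF that(1,3)] p_pos[OF that(1,3)] \<rho>[OF that(1)]
      by (auto intro!: divide_nonneg_nonneg frac_le)
    have \<xi>: "\<xi> t \<omega> = 0 \<or> \<xi> t \<omega> = 1" using \<xi>01[OF that(1,3)] by auto
    show "0 \<le> Z t u \<omega>" unfolding Z using * \<xi> r1 by (intro mult_nonneg_nonneg) auto
    have "(1 - r) * (loss t \<omega> / p t \<omega>) \<le> 1 * (1 / \<rho> t)"
      using * r0 r1 by (intro mult_mono) auto
    then show "Z t u \<omega> \<le> 1 / \<rho> t" unfolding Z using * \<xi> by (cases "U t \<omega> < u") auto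
  qed
  have Zint: "integrable M (Z t u)" if "t \<ge> 1" "u \<in> \<U>" for t u
    by (rule integrable_const_bound[of _ "1 / \<rho> t"])
      (use Z0 Z1 that measurable_from_subalg[OF sub ZF] in \<open>auto intro!: AE_I2\<close>)

  \<comment> \<open>Domination of the conditional risk by the conditional mean of
    \<open>Z\<close>\<close>
  define m where "m t u = real_cond_exp M (F (t - 1)) (\<lambda>\<omega>. loss t \<omega> * of_bool (\<xi>u t u \<omega> = 0))" for t u
  \<comment> \<open>After the draws are replaced by their probabilities, the risk averages
    \<open>(1 - \<rho> t) * loss t\<close> and \<open>Z\<close> averages
    \<open>(1 - r) * loss t\<close>, both on scores below \<open>u\<close>. Then
    \<open>r \<le> \<rho> t\<close> compares them.\<close>
  have le: "AE \<omega> in M. m t u \<omega> \<le> real_cond_exp M (F (t - 1)) (Z t u) \<omega>" if t: "t \<ge> 1" and u: "u \<in> \<U>" for t u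
  proof -
    interpret N: finite_measure_subalgebra M "F (t - 1)" by (rule fin)
    note [measurable] = lossM[OF t] UM[OF t] \<xi>uM[OF t u] \<xi>M[OF t]
    have [measurable]: "p t \<in> borel_measurable M" by (rule measurable_from_subalg[OF sub pF[OF t]])
    \<comment> \<open>\<open>q\<close> is the success probability of \<open>\<xi>u t u\<close> given
      \<open>G t\<close>, and \<open>g\<close> below is \<open>Z t u\<close> with the draw
      removed.\<close>
    define q where "q \<omega> = of_bool (U t \<omega> \<ge> u) + \<rho> t * of_bool (U t \<omega> < u)" for \<omega>
    define g where "g \<omega> = (1 - r) * (loss t \<omega> / p t \<omega>) * of_bool (U t \<omega> < u)" for \<omega>
    have qM [measurable]: "q \<in> borel_measurable M" unfolding q_def by measurable
    have gG: "g \<in> borel_measurable (G t)"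
      unfolding g_def using lossG[OF t] pG[OF t] UG[OF t] by measurable
    have gM [measurable]: "g \<in> borel_measurable M" by (rule measurable_from_subalg[OF subG[OF t] gG])
    have Zg: "Z t u \<omega> = g \<omega> * \<xi> t \<omega>" if "\<omega> \<in> space M" for \<omega>
      using step3(1)[OF t u that] by (simp add: g_def r_def)
    have [measurable]: "Z t u \<in> borel_measurable M" using Zint[OF t u] by auto
    have gint: "integrable M (\<lambda>\<omega>. g \<omega> * \<xi> t \<omega>)"
      using Zint[OF t u] by (rule Bochner_Integration.integrable_cong[OF refl, THEN iffD1, rotated]) (simp add: Zg)
    have gp: "g \<omega> * p t \<omega> = (1 - r) * loss t \<omega> * of_bool (U t \<omega> < u)" if "\<omega> \<in> space M" for \<omega>
      using p_pos[OF t that] by (simp add: g_def)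
    have q01: "0 \<le> q \<omega>" "q \<omega> \<le> 1" for \<omega>
      using \<rho>[OF t] by (auto simp: q_def)
    have i1: "integrable M (loss t)"
      by (rule integrable_const_bound[of _ 1]) (use loss01[OF t] in \<open>auto intro!: AE_I2\<close>)
    have i2: "integrable M (\<lambda>\<omega>. loss t \<omega> * \<xi>u t u \<omega>)"
      by (rule integrable_const_bound[of _ 1])
        (use loss01[OF t] \<xi>u01[OF t u] in \<open>fastforce intro!: AE_I2\<close>, measurable)
    have i3: "integrable M (\<lambda>\<omega>. loss t \<omega> * q \<omega>)"
      by (rule integrable_const_bound[of _ 1])
        (use loss01[OF t] q01 in \<open>auto intro!: AE_I2 mult_le_one\<close>)
    have i4: "integrable M (\<lambda>\<omega>. g \<omega> * p t \<omega>)"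
    proof (rule integrable_const_bound[of _ 1])
      show "AE \<omega> in M. norm (g \<omega> * p t \<omega>) \<le> 1"
        using loss01[OF t] r0 r1 by (intro AE_I2) (simp add: gp abs_mult mult_le_one)
    qed measurable
    \<comment> \<open>As \<open>\<xi>u t u\<close> takes only the values 0 and 1, the indicator of
      the value 0 is linear in it.\<close>
    have "AE \<omega> in M. m t u \<omega> = real_cond_exp M (F (t - 1)) (\<lambda>\<omega>. loss t \<omega> - loss t \<omega> * \<xi>u t u \<omega>) \<omega>"
      unfolding m_def
    proof (rule N.real_cond_exp_cong)
      show "AE \<omega> in M. loss t \<omega> * of_bool (\<xi>u t u \<omega> = 0) = loss t \<omega> - loss t \<omega> * \<xi>u t u \<omega>"
        using \<xi>u01[OF t u] by (intro AE_I2) force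
    qed measurable
    moreover have "AE \<omega> in M. real_cond_exp M (F (t - 1)) (\<lambda>\<omega>. loss t \<omega> - loss t \<omega> * \<xi>u t u \<omega>) \<omega> =
        real_cond_exp M (F (t - 1)) (loss t) \<omega> - real_cond_exp M (F (t - 1)) (\<lambda>\<omega>. loss t \<omega> * \<xi>u t u \<omega>) \<omega>"
      by (rule N.real_cond_exp_diff[OF i1 i2])
    moreover have "AE \<omega> in M. real_cond_exp M (F (t - 1)) (\<lambda>\<omega>. loss t \<omega> * \<xi>u t u \<omega>) \<omega> =
        real_cond_exp M (F (t - 1)) (\<lambda>\<omega>. loss t \<omega> * q \<omega>) \<omega>"
      by (rule N.cond_exp_mult_bernoulli[OF subG[OF t] GF _ lossG[OF t] qM i2])
        (use xi_u[OF t u] in \<open>simp add: G_def q_def[abs_def]\<close>)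
    moreover have "AE \<omega> in M. real_cond_exp M (F (t - 1)) (\<lambda>\<omega>. loss t \<omega> - loss t \<omega> * q \<omega>) \<omega> =
        real_cond_exp M (F (t - 1)) (loss t) \<omega> - real_cond_exp M (F (t - 1)) (\<lambda>\<omega>. loss t \<omega> * q \<omega>) \<omega>"
      by (rule N.real_cond_exp_diff[OF i1 i3])
    moreover have "AE \<omega> in M. real_cond_exp M (F (t - 1)) (\<lambda>\<omega>. loss t \<omega> - loss t \<omega> * q \<omega>) \<omega> \<le>
        real_cond_exp M (F (t - 1)) (\<lambda>\<omega>. g \<omega> * p t \<omega>) \<omega>"
    proof (rule N.real_cond_exp_mono)
      show "AE \<omega> in M. loss t \<omega> - loss t \<omega> * q \<omega> \<le> g \<omega> * p t \<omega>"
      proof (rule AE_I2)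
        fix \<omega> assume w: "\<omega> \<in> space M"
        have "(1 - \<rho> t) * loss t \<omega> \<le> (1 - r) * loss t \<omega>"
          using r_le[OF t] loss01[OF t w] by (intro mult_right_mono) auto
        then show "loss t \<omega> - loss t \<omega> * q \<omega> \<le> g \<omega> * p t \<omega>"
          unfolding gp[OF w] q_def by (cases "U t \<omega> < u") (auto simp: algebra_simps)
      qed
    qed (use i1 i3 i4 in auto)
    \<comment> \<open>Averaging the draw produces \<open>p t\<close>, which cancels the importance
      weight contained in \<open>g\<close>.\<close>
    moreover have "AE \<omega> in M. real_cond_exp M (F (t - 1)) (\<lambda>\<omega>. g \<omega> * \<xi> t \<omega>) \<omega> =
        real_cond_exp M (F (t - 1)) (\<lambda>\<omega>. g \<omega> * p t \<omega>) \<omega>"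
      by (rule N.cond_exp_mult_bernoulli[OF subG[OF t] GF _ gG _ gint])
        (use step2[OF t] in \<open>simp_all add: G_def\<close>)
    moreover have "AE \<omega> in M. real_cond_exp M (F (t - 1)) (Z t u) \<omega> =
        real_cond_exp M (F (t - 1)) (\<lambda>\<omega>. g \<omega> * \<xi> t \<omega>) \<omega>"
      by (rule N.real_cond_exp_cong) (auto simp: Zg)
    ultimately show ?thesis
      by eventually_elim linarith
  qed

  \<comment> \<open>No score lies below 0, so \<open>Z t 0\<close> vanishes and the domination above
    forces the risk at 0 to be nonpositive.\<close>
  have m0: "AE \<omega> in M. m t 0 \<omega> \<le> 0" if t: "t \<ge> 1" for t
  proof -
    interpret N: finite_measure_subalgebra M "F (t - 1)" by (rule fin)
    have Z0: "Z t 0 \<omega> = 0" if "\<omega> \<in> space M" for \<omega>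
      using U01[OF t that] step3(1)[OF t grid(3) that] by simp
    have "AE \<omega> in M. real_cond_exp M (F (t - 1)) (Z t 0) \<omega> \<le> 0"
      by (rule N.real_cond_exp_le_c[OF Zint[OF t grid(3)]]) (auto simp: Z0)
    with le[OF t grid(3)] show ?thesis by eventually_elim linarith
  qed

  \<comment> \<open>Bad events of the single grid points\<close>
  define B where "B u = {\<omega>\<in>space M. \<exists>t. (\<Prod>j=1..t. 1 + bet j u \<omega> * (\<epsilon> - Z j u \<omega>)) \<ge> 1 / (\<alpha> * \<nu> u)
      \<and> (\<Sum>j=1..t. bet j u \<omega> * (\<epsilon> - m j u \<omega>)) \<le> 0}" for u
  have B: "B u \<in> sets M" "measure M (B u) \<le> \<alpha> * \<nu> u" if u: "u \<in> \<U>" for u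
  proof -
    have nonneg: "0 \<le> 1 + bet t u \<omega> * (\<epsilon> - Z t u \<omega>)" if "t \<ge> 1" "\<omega> \<in> space M" for t \<omega>
      using bets(3)[OF that(1) u that(2)] step3(2)[OF that(1) u that(2)] by simp
    have c: "0 < 1 / (\<alpha> * \<nu> u)" using \<alpha> prior(1)[OF u] by simp
    have \<epsilon>0: "0 \<le> \<epsilon>" using \<epsilon> by simp
    have mF: "m t u \<in> borel_measurable (F (t - 1))" for t
      unfolding m_def by (rule borel_measurable_cond_exp)
    note ville = wealth_ville[where F = F and b = "\<lambda>t. bet t u" and Z = "\<lambda>t. Z t u" and m = "\<lambda>t. m t u"
        and e = \<epsilon>, OF \<open>prob_space M\<close> sub mono bets(1)[OF _ u] bets(2)[OF _ u] ZF[OF _ u]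
        Zint[OF _ u] Z0[OF _ u] nonneg \<epsilon>0 mF le[OF _ u] c]
    show "B u \<in> sets M" unfolding B_def by (rule ville(1))
    have "measure M (B u) \<le> 1 / (1 / (\<alpha> * \<nu> u))" unfolding B_def by (rule ville(2))
    then show "measure M (B u) \<le> \<alpha> * \<nu> u" by simp
  qed

  \<comment> \<open>This puts the wealth recursion into the product form used in
    \<open>B\<close>.\<close>
  have Kprod: "K t u \<omega> = (\<Prod>j=1..t. 1 + bet j u \<omega> * (\<epsilon> - Z j u \<omega>))" if "u \<in> \<U>" "\<omega> \<in> space M" for t u \<omega>
  proof (induction t)
    case 0
    then show ?case using that by (simp add: K_0)
  next
    case (Suc t)
    then show ?case
      using step4[of "Suc t" u \<omega>] step3(2)[of "Suc t" u \<omega>] that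
      by (subst prod.nat_ivl_Suc') (auto simp: mult.commute)
  qed

  \<comment> \<open>Covering the failure event and the union bound\<close>
  define E where "E = {\<omega>\<in>space M. \<forall>t\<ge>1. weighted_risk M F bet loss \<xi>u t (uhat t \<omega>) \<omega> \<le> \<epsilon>}"
  \<comment> \<open>The almost sure bounds at threshold 0 are countably many, so one null set
    collects all their exceptions.\<close>
  define N0 where "N0 = {\<omega>\<in>space M. \<exists>t\<ge>1. \<not> m t 0 \<omega> \<le> 0}"
  have [measurable]: "m t u \<in> borel_measurable M" for t u unfolding m_def by measurable
  have N0M: "N0 \<in> sets M" unfolding N0_def by measurable
  have "AE \<omega> in M. \<forall>t\<ge>1. m t 0 \<omega> \<le> 0"
    unfolding AE_all_countable using m0 by (auto intro: AE_I2)
  then have "AE \<omega> in M. \<omega> \<notin> N0" by eventually_elim (auto simp: N0_def)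
  then have N0: "measure M N0 = 0" using N0M by (simp add: prob_eq_0)

  \<comment> \<open>The default value 0 is itself a grid point.\<close>
  have uhat\<U>: "uhat t \<omega> \<in> \<U>" if "t \<ge> 1" "\<omega> \<in> space M" for t \<omega>
    using step5[OF that] grid(3) threshold_cases[OF grid(1)] by metis
  \<comment> \<open>The threshold is random but has values in a finite grid, so \<open>E\<close> is
    a countable intersection of events in which \<open>u\<close> is fixed. The shift to
    \<open>Suc t\<close> encodes \<open>t \<ge> 1\<close>.\<close>
  have EM: "E \<in> sets M"
  proof -
    have "{\<omega>\<in>space M. uhat t \<omega> = u \<longrightarrow> weighted_risk M F bet loss \<xi>u t u \<omega> \<le> \<epsilon>} \<in> sets M"
      if "t \<ge> 1" "u \<in> \<U>" for t u
    proof -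
      have [measurable]: "uhat t \<in> borel_measurable M"
        by (rule measurable_from_subalg[OF sub uhatF])
      have [measurable]: "weighted_risk M F bet loss \<xi>u t u \<in> borel_measurable M"
        by (rule borel_measurable_weighted_risk)
          (use that measurable_from_subalg[OF sub bets(1)] in auto)
      show ?thesis by measurable
    qed
    then have "{\<omega>\<in>space M. \<forall>t. \<forall>u\<in>\<U>. uhat (Suc t) \<omega> = u \<longrightarrow> weighted_risk M F bet loss \<xi>u (Suc t) u \<omega> \<le> \<epsilon>} \<in> sets M"
      using grid(1) by (intro sets.sets_Collect_countable_All sets.sets_Collect_finite_All) simp_all
    also have "{\<omega>\<in>space M. \<forall>t. \<forall>u\<in>\<U>. uhat (Suc t) \<omega> = u \<longrightarrow> weighted_risk M F bet loss \<xi>u (Suc t) u \<omega> \<le> \<epsilon>} = E"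
    proof -
      have "(\<forall>t\<ge>1. P t) \<longleftrightarrow> (\<forall>t. P (Suc t))" for P :: "nat \<Rightarrow> bool"
        by (metis One_nat_def Suc_le_D Suc_le_mono le0)
      then show ?thesis using uhat\<U> by (simp add: E_def cong: conj_cong)
    qed
    finally show ?thesis .
  qed

  have cover: "space M - E \<subseteq> N0 \<union> (\<Union>u\<in>\<U>. B u)"
  proof
    fix \<omega> assume "\<omega> \<in> space M - E"
    then obtain t where w: "\<omega> \<in> space M" and t: "t \<ge> 1"
      and gt: "weighted_risk M F bet loss \<xi>u t (uhat t \<omega>) \<omega> > \<epsilon>"
      by (auto simp: E_def not_le)
    have u: "uhat t \<omega> \<in> \<U>" by (rule uhat\<U>[OF t w])
    have b: "bet j (uhat t \<omega>) \<omega> \<ge> 0" if "j \<in> {1..t}" for j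
      using bets(2)[OF _ u w] that by auto
    show "\<omega> \<in> N0 \<union> (\<Union>u\<in>\<U>. B u)"
    proof (cases "uhat t \<omega> = 0")
      case True
      \<comment> \<open>A risk above the positive \<open>\<epsilon>\<close> at threshold 0 needs a
        positive conditional risk at some time, which happens only on \<open>N0\<close>.\<close>
      have "\<not> (\<forall>j\<in>{1..t}. m j 0 \<omega> \<le> 0)"
        using weighted_risk_nonpos[of t bet "uhat t \<omega>" \<omega> M F loss \<xi>u] b gt \<epsilon> True
        by (fastforce simp: m_def)
      then show ?thesis using w by (auto simp: N0_def)
    next
      case False
      have "K t (uhat t \<omega>) \<omega> \<ge> 1 / (\<alpha> * \<nu> (uhat t \<omega>))"
        using threshold_cases[OF grid(1), of \<nu> \<alpha> "\<lambda>u. K t u \<omega>"] False step5[OF t w] by metis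
      then have "\<omega> \<in> B (uhat t \<omega>)"
        using weighted_risk_gt_imp[OF b _ gt] w \<epsilon>
        by (auto simp: B_def Kprod[OF u w] m_def intro!: exI[of _ t])
      then show ?thesis using u by blast
    qed
  qed
  have "1 - measure M E = measure M (space M - E)"
    using prob_compl[OF EM] by simp
  also have "\<dots> \<le> measure M (N0 \<union> (\<Union>u\<in>\<U>. B u))"
    using cover N0M B(1) grid(1) by (intro finite_measure_mono sets.Un sets.finite_UN) auto
  also have "\<dots> \<le> measure M N0 + measure M (\<Union>u\<in>\<U>. B u)"
    using N0M B(1) grid(1) by (intro measure_Un_le sets.finite_UN) auto
  \<comment> \<open>The prior splits the error budget: grid point \<open>u\<close> receives
    \<open>\<alpha> * \<nu> u\<close>, and these shares sum to \<open>\<alpha>\<close>.\<close>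
  also have "\<dots> \<le> 0 + (\<Sum>u\<in>\<U>. measure M (B u))"
    unfolding N0 using B(1) grid(1) by (intro add_left_mono measure_UNION_le) auto
  also have "\<dots> \<le> 0 + (\<Sum>u\<in>\<U>. \<alpha> * \<nu> u)"
    by (intro add_left_mono sum_mono B(2))
  also have "\<dots> = \<alpha>" by (simp add: prior(2) flip: sum_distrib_left)
  finally show ?thesis by (simp add: E_def)
qed

end
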